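(* Let $n\in\mathbb{N}$. In every $n$-Legendrian predicate rack, for all elements $a,b$: $D(a,b)$ holds if and only if $b=a^{n+1}$.
   Context: $\mathbb{N}=\{0,1,2,\dots\}$. A rack is a set $R$ with two binary operations $*$ and $/$ such that for all $x,y,z\in R$: $(x*y)*z=(x*z)*(y*z)$, $(x/y)/z=(x/z)/(y/z)$, $(x*y)/y=x$, $(x/y)*y=x$. Powers $x^m$ are defined for $m\in\mathbb{Z}\setminus\{0,-1\}$ by $x^1=x$, $x^m=x^{m-1}*x$ for $m>1$, $x^{-2}=x/x$, $x^m=x^{m+1}/x$ for $m<-2$. An $n$-Legendrian predicate rack is a rack together with two binary predicates $U$ and $D$ on it such that for all $x,y,z$: (1a) $(U(x*z,y)\wedge D(y,z))\leftrightarrow (x=z\wedge y=x^{n+2})$; (1b) $(D(y,z/x)\wedge U(x,y))\leftrightarrow (x=z\wedge y=x^{-(n+2)})$; (1c) $(D(x,y)\wedge U(y,z/x))\leftrightarrow (x=z\wedge y=x^{-(n+2)})$; (1d) $(D(x*z,y)\wedge U(y,z))\leftrightarrow (x=z\wedge y=x^{n+2})$; (2a) $U(x,y)\leftrightarrow U(x*z,y*z)$; (2b) $D(x,y)\leftrightarrow D(x*z,y*z)$; (2c) $U(x,y)\rightarrow (z/x)*y=z$; (2d) $D(x,y)\rightarrow (z*y)/x=z$. *)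

theory Defs
  imports Main
begin

text \<open>
  Powers are meant for exponents other than 0 and -1; at these two exponents the
  value is the unspecified element \<open>undefined\<close>. They need only the two operations,
  so they are introduced before the rack axioms.
\<close>

function rack_power :: "('a \<Rightarrow> 'a \<Rightarrow> 'a) \<Rightarrow> ('a \<Rightarrow> 'a \<Rightarrow> 'a) \<Rightarrow> 'a \<Rightarrow> int \<Rightarrow> 'a" where
  "rack_power star slash x m =
    (if m = 1 then x
     else if m > 1 then star (rack_power star slash x (m - 1)) x
     else if m = -2 then slash x x
     else if m < -2 then slash (rack_power star slash x (m + 1)) x
     else undefined)"
  by auto
termination
  by (relation "measure (\<lambda>(_, _, _, m). nat \<bar>m\<bar>)") auto

declare rack_power.simps [simp del]

locale rack =
  fixes R :: "'a set"
    and star :: "'a \<Rightarrow> 'a \<Rightarrow> 'a"  (infixl \<open>\<star>\<close> 70)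
    and slash :: "'a \<Rightarrow> 'a \<Rightarrow> 'a"  (infixl \<open>\<oslash>\<close> 70)
  assumes star_closed: "\<lbrakk>x \<in> R; y \<in> R\<rbrakk> \<Longrightarrow> x \<star> y \<in> R"
    and slash_closed: "\<lbrakk>x \<in> R; y \<in> R\<rbrakk> \<Longrightarrow> x \<oslash> y \<in> R"
    and star_distrib: "\<lbrakk>x \<in> R; y \<in> R; z \<in> R\<rbrakk> \<Longrightarrow> (x \<star> y) \<star> z = (x \<star> z) \<star> (y \<star> z)"
    and slash_distrib: "\<lbrakk>x \<in> R; y \<in> R; z \<in> R\<rbrakk> \<Longrightarrow> (x \<oslash> y) \<oslash> z = (x \<oslash> z) \<oslash> (y \<oslash> z)"
    and star_slash: "\<lbrakk>x \<in> R; y \<in> R\<rbrakk> \<Longrightarrow> (x \<star> y) \<oslash> y = x"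
    and slash_star: "\<lbrakk>x \<in> R; y \<in> R\<rbrakk> \<Longrightarrow> (x \<oslash> y) \<star> y = x"
begin

abbreviation power_R :: "'a \<Rightarrow> int \<Rightarrow> 'a"  (infixr \<open>\<up>\<close> 80)
  where "x \<up> m \<equiv> rack_power star slash x m"

end

locale legendrian_predicate_rack = rack R star slash
  for R :: "'a set"
    and star :: "'a \<Rightarrow> 'a \<Rightarrow> 'a"  (infixl \<open>\<star>\<close> 70)
    and slash :: "'a \<Rightarrow> 'a \<Rightarrow> 'a"  (infixl \<open>\<oslash>\<close> 70) +
  fixes n :: nat
    and U D :: "'a \<Rightarrow> 'a \<Rightarrow> bool"
  assumes ax_1a: "\<lbrakk>x \<in> R; y \<in> R; z \<in> R\<rbrakk> \<Longrightarrow>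
      (U (x \<star> z) y \<and> D y z) \<longleftrightarrow> (x = z \<and> y = x \<up> (int n + 2))"
    and ax_1b: "\<lbrakk>x \<in> R; y \<in> R; z \<in> R\<rbrakk> \<Longrightarrow>
      (D y (z \<oslash> x) \<and> U x y) \<longleftrightarrow> (x = z \<and> y = x \<up> (- (int n + 2)))"
    and ax_1c: "\<lbrakk>x \<in> R; y \<in> R; z \<in> R\<rbrakk> \<Longrightarrow>
      (D x y \<and> U y (z \<oslash> x)) \<longleftrightarrow> (x = z \<and> y = x \<up> (- (int n + 2)))"
    and ax_1d: "\<lbrakk>x \<in> R; y \<in> R; z \<in> R\<rbrakk> \<Longrightarrow>
      (D (x \<star> z) y \<and> U y z) \<longleftrightarrow> (x = z \<and> y = x \<up> (int n + 2))"
    and ax_2a: "\<lbrakk>x \<in> R; y \<in> R; z \<in> R\<rbrakk> \<Longrightarrow> U x y \<longleftrightarrow> U (x \<star> z) (y \<star> z)"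
    and ax_2b: "\<lbrakk>x \<in> R; y \<in> R; z \<in> R\<rbrakk> \<Longrightarrow> D x y \<longleftrightarrow> D (x \<star> z) (y \<star> z)"
    and ax_2c: "\<lbrakk>x \<in> R; y \<in> R; z \<in> R\<rbrakk> \<Longrightarrow> U x y \<longrightarrow> (z \<oslash> x) \<star> y = z"
    and ax_2d: "\<lbrakk>x \<in> R; y \<in> R; z \<in> R\<rbrakk> \<Longrightarrow> D x y \<longrightarrow> (z \<star> y) \<oslash> x = z"

end

theory Submission
  imports Defs
begin

text \<open>
  Axiom (1d) at \<open>x = z = a\<close> gives \<open>D(a * a, a\<^sup>n\<^sup>+\<^sup>2)\<close> and \<open>U(a\<^sup>n\<^sup>+\<^sup>2, a)\<close>.
  Since \<open>a\<^sup>n\<^sup>+\<^sup>2 = a\<^sup>n\<^sup>+\<^sup>1 * a\<close>, cancelling \<open>a\<close> with (2b) in the former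
  yields \<open>D(a, a\<^sup>n\<^sup>+\<^sup>1)\<close>. Conversely, \<open>D(a, b)\<close> forces \<open>a\<close> and \<open>b\<close> to act equally from
  the right by (2d), so the latter reads \<open>U(a\<^sup>n\<^sup>+\<^sup>1 * b, a)\<close>, and (1a) gives \<open>b = a\<^sup>n\<^sup>+\<^sup>1\<close>.
\<close>

context rack
begin

lemma power_R_one: "x \<up> 1 = x"
  by (simp add: rack_power.simps)

text \<open>The bound keeps \<open>m\<close> and \<open>m + 1\<close> on the positive branch of the
  recursion, away from the \<open>undefined\<close> value at exponent 0.\<close>

lemma power_R_plus_one: "m \<ge> 1 \<Longrightarrow> x \<up> (m + 1) = x \<up> m \<star> x"
  by (subst rack_power.simps) simp

lemma power_R_closed:
  assumes "x \<in> R" and "m \<ge> 1"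
  shows "x \<up> m \<in> R"
  using \<open>m \<ge> 1\<close>
proof (induction m rule: int_ge_induct)
  case base
  show ?case using \<open>x \<in> R\<close> by (simp add: power_R_one)
next
  case (step m)
  then show ?case using \<open>x \<in> R\<close> by (simp add: power_R_plus_one star_closed)
qed

end

context legendrian_predicate_rack
begin

text \<open>Right multiplication by \<open>x\<close> undoes the division in (2d).\<close>

lemma D_imp_same_right_action:
  assumes "D x y" and "x \<in> R" "y \<in> R" "z \<in> R"
  shows "z \<star> y = z \<star> x"
proof -
  have "(z \<star> y) \<oslash> x \<star> x = z \<star> x"
    using ax_2d assms by simp
  then show ?thesis
    using assms by (simp add: slash_star star_closed)
qed

lemma D_iff_eq_power:
  assumes a: "a \<in> R" and b: "b \<in> R"
  shows "D a b \<longleftrightarrow> b = a \<up> (int n + 1)"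
proof -
  let ?p = "a \<up> (int n + 1)"
  have p: "?p \<in> R"
    using a by (simp add: power_R_closed)
  have pow: "a \<up> (int n + 2) = ?p \<star> a"
    using power_R_plus_one[of "int n + 1" a] by (simp add: add.assoc)
  have DU: "D (a \<star> a) (?p \<star> a)" "U (?p \<star> a) a"
    using ax_1d[of a "?p \<star> a" a] a p pow by (simp_all add: star_closed)
  show ?thesis
  proof
    assume D: "D a b"
    have "U (?p \<star> b) a"
      using DU(2) D_imp_same_right_action[OF D a b p] by simp
    \<comment> \<open>Here (1a) is read with \<open>?p\<close>, \<open>a\<close>, \<open>b\<close>
      for its \<open>x\<close>, \<open>y\<close>, \<open>z\<close>: the power sits in the first
      slot, so the conclusion \<open>x = z\<close> becomes \<open>?p = b\<close>.\<close>
    then show "b = ?p"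
      using ax_1a[OF p a b] D by simp
  next
    assume "b = ?p"
    then show "D a b"
      using ax_2b[OF a p a] DU(1) by simp
  qed
qed

end

theorem theorem4p4:
  fixes R :: "'a set"
    and star slash :: "'a \<Rightarrow> 'a \<Rightarrow> 'a"
    and n :: nat
    and U D :: "'a \<Rightarrow> 'a \<Rightarrow> bool"
    and a b :: 'a
  assumes "legendrian_predicate_rack R star slash n U D"
    and "a \<in> R" and "b \<in> R"
  shows "D a b \<longleftrightarrow> b = rack_power star slash a (int n + 1)"
  using legendrian_predicate_rack.D_iff_eq_power[OF assms] .

end
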